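(* Let $d,s,n\ge 1$ be integers, let $(\mathbf{x}^{(1)},y_1),\dots,(\mathbf{x}^{(n)},y_n)\in\mathbb{R}^d\times\mathbb{R}$, and let $\alpha>0$. Consider the two optimization problems $$\text{(P)}\quad \mathop{\rm argmin}_{f}\Big\{\sum_{i=1}^n\big(y_i-f(\mathbf{x}^{(i)})\big)^2+\alpha V^{d,s}_{\text{XGB}}(f): f\in\mathcal{F}^{d,s}_{\text{ST}}\Big\},$$ $$\text{(Q)}\quad \mathop{\rm argmin}_{f}\Big\{\sum_{i=1}^n\big(y_i-f(\mathbf{x}^{(i)})\big)^2+\alpha V^{d,s}_{\infty-\text{XGB}}(f): f\in\mathcal{F}^{d,s}_{\infty-\text{ST}}\Big\}.$$ There exists a solution to (Q) that is also a solution to (P). Moreover, every solution to (P) is also a solution to (Q).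
   Context: Regression trees. A regression tree with right-continuous splits is a function on $\mathbb{R}^d$ given by a finite binary tree in which each internal node carries a split of the form $x_j\ge t$ versus $x_j<t$ (for some $j\in[d]:=\{1,\dots,d\}$, $t\in\mathbb{R}$) and each leaf carries a real weight; its value at $\mathbf{x}$ is the weight of the leaf reached by $\mathbf{x}$. The depth is the maximum number of splits along any root-to-leaf path. A constant function is also allowed as a tree (a constant regression tree, of depth $0$). $\mathcal{F}^{d,s}_{\text{ST}}$ is the class of all finite sums $\sum_{k=1}^K f_k$ ($K\ge 1$ arbitrary) where each $f_k$ is a regression tree with right-continuous splits and depth at most $s$. XGBoost penalty. For $f\in\mathcal{F}^{d,s}_{\text{ST}}$, $V^{d,s}_{\text{XGB}}(f)=\inf\{\sum_k\|\mathbf{w}_k\|_1\}$, where the infimum is over all representations of $f$ as a finite sum of regression trees with right-continuous splits and depth at most $s$, $\mathbf{w}_k$ is the vector of leaf weights of the $k$-th tree, $\|\cdot\|_1$ is the $\ell^1$ norm, and by convention $\|\mathbf{w}_k\|_1=0$ if the $k$-th tree is a constant tree. Extended class. For (not necessarily disjoint) $L,U\subseteq[d]$ with $0<|L|+|U|\le s$ and threshold vectors $\mathbf{l}=(l_j,j\in L)$, $\mathbf{u}=(u_j,j\in U)$, let $b^{L,U}_{\mathbf{l},\mathbf{u}}(x_1,\dots,x_d)=\prod_{j\in L}\mathbf{1}(x_j\ge l_j)\cdot\prod_{j\in U}\mathbf{1}(x_j<u_j)$. For $c\in\mathbb{R}$ and finite signed Borel measures $\nu_{L,U}$ on $\mathbb{R}^{|L|+|U|}$,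 let $$f^{d,s}_{c,\{\nu_{L,U}\}}(\mathbf{x})=c+\sum_{0<|L|+|U|\le s}\int_{\mathbb{R}^{|L|+|U|}}b^{L,U}_{\mathbf{l},\mathbf{u}}(\mathbf{x})\,d\nu_{L,U}(\mathbf{l},\mathbf{u}).$$ $\mathcal{F}^{d,s}_{\infty-\text{ST}}$ is the set of all such functions (it contains $\mathcal{F}^{d,s}_{\text{ST}}$). For $f\in\mathcal{F}^{d,s}_{\infty-\text{ST}}$, $$V^{d,s}_{\infty-\text{XGB}}(f)=\inf\Big\{\sum_{0<|L|+|U|\le s}\|\nu_{L,U}\|_{\text{TV}}: f^{d,s}_{c,\{\nu_{L,U}\}}\equiv f\Big\},$$ the infimum over all such representations of $f$, where $\|\nu\|_{\text{TV}}=|\nu|(\mathbb{R}^{|L|+|U|})$ is the total variation. *)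

theory Defs
  imports "HOL-Analysis.Analysis"
begin

section \<open>Regression trees\<close>

text \<open>
  \<open>Split j t a b\<close> continues with \<open>a\<close> if \<open>x $ j \<ge> t\<close> and with \<open>b\<close> if \<open>x $ j < t\<close>.
  A constant regression tree is a single leaf.
\<close>

datatype 'd rtree = Leaf real | Split 'd real "'d rtree" "'d rtree"

primrec tree_fun :: "'d::finite rtree \<Rightarrow> real ^ 'd \<Rightarrow> real" where
  "tree_fun (Leaf w) x = w"
| "tree_fun (Split j t a b) x = (if x $ j \<ge> t then tree_fun a x else tree_fun b x)"

primrec depth :: "'d rtree \<Rightarrow> nat" where
  "depth (Leaf w) = 0"
| "depth (Split j t a b) = Suc (max (depth a) (depth b))"

primrec leaf_weights :: "'d rtree \<Rightarrow> real list" where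
  "leaf_weights (Leaf w) = [w]"
| "leaf_weights (Split j t a b) = leaf_weights a @ leaf_weights b"

text \<open>The \<open>\<ell>\<^sup>1\<close> norm of the leaf weights; by convention, constant trees are not penalized.\<close>

definition tree_penalty :: "'d rtree \<Rightarrow> real" where
  "tree_penalty T = (if depth T = 0 then 0 else (\<Sum>w\<leftarrow>leaf_weights T. \<bar>w\<bar>))"

definition ST_rep :: "nat \<Rightarrow> 'd::finite rtree list \<Rightarrow> (real ^ 'd \<Rightarrow> real) \<Rightarrow> bool" where
  "ST_rep s Ts f \<longleftrightarrow>
     Ts \<noteq> [] \<and> (\<forall>T\<in>set Ts. depth T \<le> s) \<and> f = (\<lambda>x. \<Sum>T\<leftarrow>Ts. tree_fun T x)"

definition F_ST :: "nat \<Rightarrow> (real ^ 'd::finite \<Rightarrow> real) set" where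
  "F_ST s = {f. \<exists>Ts. ST_rep s Ts f}"

definition V_XGB :: "nat \<Rightarrow> (real ^ 'd::finite \<Rightarrow> real) \<Rightarrow> real" where
  "V_XGB s f = Inf {\<Sum>T\<leftarrow>Ts. tree_penalty T | Ts. ST_rep s Ts f}"


section \<open>Finite signed measures\<close>

text \<open>
  A finite signed measure is a real-valued, countably additive set function on \<open>sets M\<close>;
  here \<open>M\<close> serves only as a measurable space.
\<close>

definition finite_signed_measure :: "'a measure \<Rightarrow> ('a set \<Rightarrow> real) \<Rightarrow> bool" where
  "finite_signed_measure M \<nu> \<longleftrightarrow>
     \<nu> {} = 0 \<and>
     (\<forall>A :: nat \<Rightarrow> 'a set. range A \<subseteq> sets M \<longrightarrow> disjoint_family A \<longrightarrow>
        (\<lambda>i. \<nu> (A i)) sums \<nu> (\<Union>i. A i))"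

text \<open>
  The two parts of the Jordan decomposition, given by
  \<open>\<nu>\<^sup>+ A = sup {\<nu> B | B \<subseteq> A measurable}\<close> and \<open>\<nu>\<^sup>- = (- \<nu>)\<^sup>+\<close>. The coercion \<open>ennreal\<close>
  truncates negative values to 0, which does not change the supremum since \<open>\<nu> {} = 0\<close>.
\<close>

definition pos_variation :: "'a measure \<Rightarrow> ('a set \<Rightarrow> real) \<Rightarrow> 'a measure" where
  "pos_variation M \<nu> =
     measure_of (space M) (sets M) (\<lambda>A. SUP B\<in>{B \<in> sets M. B \<subseteq> A}. ennreal (\<nu> B))"

definition neg_variation :: "'a measure \<Rightarrow> ('a set \<Rightarrow> real) \<Rightarrow> 'a measure" where
  "neg_variation M \<nu> = pos_variation M (\<lambda>A. - \<nu> A)"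

text \<open>\<open>\<parallel>\<nu>\<parallel> = |\<nu>| (space M)\<close>, where \<open>|\<nu>| = \<nu>\<^sup>+ + \<nu>\<^sup>-\<close>.\<close>

definition TV_norm :: "'a measure \<Rightarrow> ('a set \<Rightarrow> real) \<Rightarrow> real" where
  "TV_norm M \<nu> =
     measure (pos_variation M \<nu>) (space M) + measure (neg_variation M \<nu>) (space M)"

definition signed_integral :: "'a measure \<Rightarrow> ('a set \<Rightarrow> real) \<Rightarrow> ('a \<Rightarrow> real) \<Rightarrow> real" where
  "signed_integral M \<nu> f =
     integral\<^sup>L (pos_variation M \<nu>) f - integral\<^sup>L (neg_variation M \<nu>) f"


section \<open>The extended class\<close>

text \<open>
  The measurable space \<open>\<real>\<^bsup>|L|+|U|\<^esup>\<close> of thresholds \<open>(l, u) = ((l\<^sub>j)\<^bsub>j\<in>L\<^esub>, (u\<^sub>j)\<^bsub>j\<in>U\<^esub>)\<close>. Since \<open>L\<close> and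
  \<open>U\<close> are finite, the product \<open>\<sigma>\<close>-algebra is the Borel \<open>\<sigma>\<close>-algebra. If \<open>L\<close> (or \<open>U\<close>) is empty, the
  corresponding factor is a one-point space.
\<close>

type_synonym 'd thresholds = "('d \<Rightarrow> real) \<times> ('d \<Rightarrow> real)"

definition thr_space :: "'d set \<Rightarrow> 'd set \<Rightarrow> 'd thresholds measure" where
  "thr_space L U = (\<Pi>\<^sub>M j\<in>L. borel) \<Otimes>\<^sub>M (\<Pi>\<^sub>M j\<in>U. borel)"

definition basis_fun ::
    "'d set \<Rightarrow> 'd set \<Rightarrow> 'd::finite thresholds \<Rightarrow> real ^ 'd \<Rightarrow> real" where
  "basis_fun L U = (\<lambda>(l, u) x.
     (\<Prod>j\<in>L. of_bool (x $ j \<ge> l j)) * (\<Prod>j\<in>U. of_bool (x $ j < u j)))"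

definition index_pairs :: "nat \<Rightarrow> ('d::finite set \<times> 'd set) set" where
  "index_pairs s = {(L, U). 0 < card L + card U \<and> card L + card U \<le> s}"

definition inf_ST_fun :: "nat \<Rightarrow> real \<Rightarrow> ('d set \<Rightarrow> 'd set \<Rightarrow> 'd thresholds set \<Rightarrow> real)
    \<Rightarrow> real ^ 'd::finite \<Rightarrow> real" where
  "inf_ST_fun s c \<nu> x = c +
     (\<Sum>(L, U)\<in>index_pairs s.
        signed_integral (thr_space L U) (\<nu> L U) (\<lambda>lu. basis_fun L U lu x))"

definition inf_ST_rep :: "nat \<Rightarrow> real \<Rightarrow> ('d set \<Rightarrow> 'd set \<Rightarrow> 'd thresholds set \<Rightarrow> real)
    \<Rightarrow> (real ^ 'd::finite \<Rightarrow> real) \<Rightarrow> bool" where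
  "inf_ST_rep s c \<nu> f \<longleftrightarrow>
     (\<forall>(L, U)\<in>index_pairs s. finite_signed_measure (thr_space L U) (\<nu> L U)) \<and>
     f = inf_ST_fun s c \<nu>"

definition F_inf_ST :: "nat \<Rightarrow> (real ^ 'd::finite \<Rightarrow> real) set" where
  "F_inf_ST s = {f. \<exists>c \<nu>. inf_ST_rep s c \<nu> f}"

definition V_inf_XGB :: "nat \<Rightarrow> (real ^ 'd::finite \<Rightarrow> real) \<Rightarrow> real" where
  "V_inf_XGB s f =
     Inf {\<Sum>(L, U)\<in>index_pairs s. TV_norm (thr_space L U) (\<nu> L U) | c \<nu>. inf_ST_rep s c \<nu> f}"


section \<open>The optimization problems\<close>

definition penalized_loss :: "((real ^ 'd::finite \<Rightarrow> real) \<Rightarrow> real) \<Rightarrow> nat \<Rightarrow> (nat \<Rightarrow> real ^ 'd)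
    \<Rightarrow> (nat \<Rightarrow> real) \<Rightarrow> real \<Rightarrow> (real ^ 'd \<Rightarrow> real) \<Rightarrow> real" where
  "penalized_loss V n x y \<alpha> f = (\<Sum>i=1..n. (y i - f (x i))\<^sup>2) + \<alpha> * V f"

definition solution_P :: "nat \<Rightarrow> nat \<Rightarrow> (nat \<Rightarrow> real ^ 'd::finite) \<Rightarrow> (nat \<Rightarrow> real) \<Rightarrow> real
    \<Rightarrow> (real ^ 'd \<Rightarrow> real) \<Rightarrow> bool" where
  "solution_P s n x y \<alpha> f \<longleftrightarrow> is_arg_min (penalized_loss (V_XGB s) n x y \<alpha>) (\<lambda>g. g \<in> F_ST s) f"

definition solution_Q :: "nat \<Rightarrow> nat \<Rightarrow> (nat \<Rightarrow> real ^ 'd::finite) \<Rightarrow> (nat \<Rightarrow> real) \<Rightarrow> real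
    \<Rightarrow> (real ^ 'd \<Rightarrow> real) \<Rightarrow> bool" where
  "solution_Q s n x y \<alpha> f \<longleftrightarrow>
     is_arg_min (penalized_loss (V_inf_XGB s) n x y \<alpha>) (\<lambda>g. g \<in> F_inf_ST s) f"

end

theory Submission
  imports Defs
begin

text \<open>
  On the data, a basis function is determined by its pattern, the set of indices \<open>i\<close> at which it
  equals 1, and only finitely many patterns occur. Partitioning the threshold spaces according to
  the pattern turns any representation by signed measures into one weight per pattern, with the same
  predictions on the data and with \<open>\<ell>\<^sup>1\<close> norm at most the total variation. Weighted
  sums of basis functions can be written as sums of trees at the cost of the \<open>\<ell>\<^sup>1\<close> norm, and
  conversely splitting a tree into its leaves bounds \<open>V_inf_XGB\<close> by \<open>V_XGB\<close> on \<open>F_ST\<close>. Hence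
  both problems have the same optimal value as a finite-dimensional \<open>\<ell>\<^sup>1\<close>-penalized least squares
  problem, whose minimizer, realized as a sum of trees, solves both.
\<close>

section \<open>Finite signed measures\<close>

lemma signed_measure_Un:
  assumes "finite_signed_measure M \<nu>" "A \<in> sets M" "B \<in> sets M" "A \<inter> B = {}"
  shows "\<nu> (A \<union> B) = \<nu> A + \<nu> B"
proof -
  have "range (binaryset A B) \<subseteq> sets M" "disjoint_family (binaryset A B)"
    using assms by (auto simp: range_binaryset_eq disjoint_family_on_def binaryset_def)
  then have "(\<lambda>i. \<nu> (binaryset A B i)) sums \<nu> (\<Union>i. binaryset A B i)"
    using assms unfolding finite_signed_measure_def by blast
  moreover have "(\<lambda>i. \<nu> (binaryset A B i)) sums (\<nu> A + \<nu> B)"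
    using assms by (intro binaryset_sums) (simp add: finite_signed_measure_def)
  ultimately show ?thesis
    using sums_unique2 by (force simp: UN_binaryset_eq)
qed

text \<open>If \<open>\<nu>\<close> were unbounded, splitting off a piece of mass at least 1 while keeping an unbounded
  remainder could be repeated forever, producing a divergent series.\<close>

lemma signed_measure_bounded_above:
  assumes \<nu>: "finite_signed_measure M \<nu>"
  shows "\<exists>K. \<forall>B\<in>sets M. \<nu> B \<le> K"
proof (rule ccontr)
  assume no: "\<nexists>K. \<forall>B\<in>sets M. \<nu> B \<le> K"
  \<comment> \<open>\<open>U A\<close> says that \<nu> is unbounded above on the measurable subsets
    of \<open>A\<close>. By additivity this passes to at least one of the two pieces of any
    measurable splitting of \<open>A\<close>.\<close>
  define U where "U A \<longleftrightarrow> A \<in> sets M \<and> (\<forall>K. \<exists>B\<in>sets M. B \<subseteq> A \<and> \<nu> B > K)" for A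
  have split: "U B \<or> U (A - B)" if "U A" "B \<in> sets M" "B \<subseteq> A" for A B
  proof (rule ccontr)
    assume "\<not> (U B \<or> U (A - B))"
    moreover have "B \<in> sets M" "A - B \<in> sets M" using that by (auto simp: U_def)
    ultimately have ex: "\<exists>K. \<forall>C\<in>sets M. C \<subseteq> B \<longrightarrow> \<nu> C \<le> K"
      "\<exists>K. \<forall>C\<in>sets M. C \<subseteq> A - B \<longrightarrow> \<nu> C \<le> K"
      by (simp_all add: U_def not_less)
    obtain K1 where K1: "\<forall>C\<in>sets M. C \<subseteq> B \<longrightarrow> \<nu> C \<le> K1" using ex(1) ..
    obtain K2 where K2: "\<forall>C\<in>sets M. C \<subseteq> A - B \<longrightarrow> \<nu> C \<le> K2" using ex(2) ..
    obtain C where C: "C \<in> sets M" "C \<subseteq> A" "\<nu> C > K1 + K2"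
      using \<open>U A\<close> unfolding U_def by blast
    have "\<nu> C = \<nu> ((C \<inter> B) \<union> (C - B))" by (simp add: Int_Diff_Un)
    also have "\<dots> = \<nu> (C \<inter> B) + \<nu> (C - B)"
      using C that by (intro signed_measure_Un[OF \<nu>]) auto
    also have "\<dots> \<le> K1 + K2" using C that by (intro add_mono K1[rule_format] K2[rule_format]) auto
    finally show False using C by simp
  qed
  have step: "\<exists>B. U B \<and> B \<subseteq> A \<and> \<bar>\<nu> (A - B)\<bar> \<ge> 1" if "U A" for A
  proof -
    \<comment> \<open>The threshold \<open>1 + \<bar>\<nu> A\<bar>\<close> makes both
      \<open>B\<close> and \<open>A - B\<close> have mass at least 1 in absolute value, so whichever
      of them inherits \<open>U\<close> can be kept and the other discarded.\<close>
    obtain B where B: "B \<in> sets M" "B \<subseteq> A" "\<nu> B > 1 + \<bar>\<nu> A\<bar>"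
      using \<open>U A\<close> unfolding U_def by blast
    have "\<nu> A = \<nu> (B \<union> (A - B))" using B by (simp add: Un_absorb1)
    also have "\<dots> = \<nu> B + \<nu> (A - B)"
      using B that by (intro signed_measure_Un[OF \<nu>]) (auto simp: U_def)
    finally have "\<bar>\<nu> (A - B)\<bar> \<ge> 1" using B by linarith
    moreover have "\<bar>\<nu> (A - (A - B))\<bar> \<ge> 1" using B by (simp add: double_diff)
    ultimately show ?thesis using split[OF that B(1,2)] B by blast
  qed
  have "U (space M)" using no unfolding U_def by (meson not_le sets.sets_into_space sets.top)
  define F where "F = rec_nat (space M) (\<lambda>_ A. SOME B. U B \<and> B \<subseteq> A \<and> \<bar>\<nu> (A - B)\<bar> \<ge> 1)"
  have FS: "F (Suc i) = (SOME B. U B \<and> B \<subseteq> F i \<and> \<bar>\<nu> (F i - B)\<bar> \<ge> 1)" for i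
    by (simp add: F_def)
  have UF: "U (F i)" for i
  proof (induction i)
    case 0
    show ?case using \<open>U (space M)\<close> by (simp add: F_def)
  next
    case (Suc i)
    show ?case unfolding FS using someI_ex[OF step[OF Suc]] by blast
  qed
  have F: "F (Suc i) \<subseteq> F i" "\<bar>\<nu> (F i - F (Suc i))\<bar> \<ge> 1" for i
    unfolding FS using someI_ex[OF step[OF UF[of i]]] by blast+
  have "decseq F" using F(1) by (simp add: decseq_Suc_iff)
  \<comment> \<open>The discarded pieces are the successive differences of a decreasing sequence.
    Countable additivity makes the series of their masses converge, so the masses would have to tend
    to 0.\<close>
  have disj: "disjoint_family (\<lambda>i. F i - F (Suc i))"
  proof -
    have "(F i - F (Suc i)) \<inter> (F j - F (Suc j)) = {}" if "i < j" for i j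
      using decseqD[OF \<open>decseq F\<close>, of "Suc i" j] that by auto
    then show ?thesis unfolding disjoint_family_on_def
      by (metis inf_commute nat_neq_iff)
  qed
  have "range (\<lambda>i. F i - F (Suc i)) \<subseteq> sets M" using UF by (auto simp: U_def)
  then have "(\<lambda>i. \<nu> (F i - F (Suc i))) sums \<nu> (\<Union>i. F i - F (Suc i))"
    using \<nu> disj unfolding finite_signed_measure_def by blast
  then have "(\<lambda>i. \<nu> (F i - F (Suc i))) \<longlonglongrightarrow> 0"
    using sums_summable summable_LIMSEQ_zero by blast
  then obtain i where "\<bar>\<nu> (F i - F (Suc i))\<bar> < 1"
    using LIMSEQ_D[of _ 0 1] by fastforce
  then show False using F(2)[of i] by linarith
qed

lemma space_pos_variation [simp]: "space (pos_variation M \<nu>) = space M"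
  and sets_pos_variation [simp]: "sets (pos_variation M \<nu>) = sets M"
  by (simp_all add: pos_variation_def)

lemma space_neg_variation [simp]: "space (neg_variation M \<nu>) = space M"
  and sets_neg_variation [simp]: "sets (neg_variation M \<nu>) = sets M"
  by (simp_all add: neg_variation_def)

lemma finite_signed_measure_uminus:
  "finite_signed_measure M \<nu> \<Longrightarrow> finite_signed_measure M (\<lambda>A. - \<nu> A)"
  by (auto simp: finite_signed_measure_def intro!: sums_minus)

text \<open>No Jordan decomposition is needed here: if the supremum were not a measure,
  \<^const>\<open>measure_of\<close> would return the zero measure.\<close>

lemma finite_measure_pos_variation:
  assumes "finite_signed_measure M \<nu>"
  shows "finite_measure (pos_variation M \<nu>)"
proof
  obtain K where K: "\<And>B. B \<in> sets M \<Longrightarrow> \<nu> B \<le> K"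
    using signed_measure_bounded_above[OF assms] by blast
  have "emeasure (pos_variation M \<nu>) (space M) \<le> (SUP B\<in>{B \<in> sets M. B \<subseteq> space M}. ennreal (\<nu> B))"
    unfolding pos_variation_def by (subst emeasure_measure_of_conv) auto
  also have "\<dots> \<le> ennreal K" using K by (intro SUP_least) (auto intro: ennreal_leI)
  finally have le: "emeasure (pos_variation M \<nu>) (space M) \<le> ennreal K" .
  show "emeasure (pos_variation M \<nu>) (space (pos_variation M \<nu>)) \<noteq> \<infinity>"
    unfolding space_pos_variation using le_less_trans[OF le ennreal_less_top] by (simp only: infinity_ennreal_def)
qed

lemma finite_measure_neg_variation:
  "finite_signed_measure M \<nu> \<Longrightarrow> finite_measure (neg_variation M \<nu>)"
  unfolding neg_variation_def by (intro finite_measure_pos_variation finite_signed_measure_uminus)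

lemma TV_norm_nonneg: "TV_norm M \<nu> \<ge> 0"
  by (simp add: TV_norm_def)

text \<open>\<open>g \<circ> f\<close> is a simple function, a combination of the indicators of the
  fibres of \<open>f\<close>. Later \<open>f\<close> is the pattern map on thresholds, and
  \<open>g\<close> tests membership of a data index or is constantly 1.\<close>

lemma integral_finite_range:
  fixes g :: "'b \<Rightarrow> real"
  assumes "finite_measure N" "finite F" "\<And>q. q \<in> space N \<Longrightarrow> f q \<in> F"
    and meas: "\<And>P. P \<in> F \<Longrightarrow> {q \<in> space N. f q = P} \<in> sets N"
  shows "integral\<^sup>L N (\<lambda>q. g (f q)) = (\<Sum>P\<in>F. g P * measure N {q \<in> space N. f q = P})"
proof -
  interpret finite_measure N by fact
  have "integral\<^sup>L N (\<lambda>q. g (f q)) =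
      integral\<^sup>L N (\<lambda>q. \<Sum>P\<in>F. g P * indicator {q \<in> space N. f q = P} q)"
  proof (rule Bochner_Integration.integral_cong)
    fix q assume q: "q \<in> space N"
    have "(\<Sum>P\<in>F. g P * indicator {q \<in> space N. f q = P} q) = (\<Sum>P\<in>F. if P = f q then g P else 0)"
      using q by (intro sum.cong) (auto simp: indicator_def)
    then show "g (f q) = (\<Sum>P\<in>F. g P * indicator {q \<in> space N. f q = P} q)"
      using assms(2,3) q by simp
  qed simp
  also have "\<dots> = (\<Sum>P\<in>F. integral\<^sup>L N (\<lambda>q. g P * indicator {q \<in> space N. f q = P} q))"
    using meas by (intro Bochner_Integration.integral_sum integrable_mult_right integrable_real_indicator)
      (auto simp: emeasure_eq_measure)
  also have "\<dots> = (\<Sum>P\<in>F. g P * measure N {q \<in> space N. f q = P})"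
    using meas by (intro sum.cong) (auto intro!: arg_cong[where f="measure N"])
  finally show ?thesis .
qed

section \<open>Point masses\<close>

text \<open>\<open>point_measure\<close> lives on the power set of \<open>S\<close>; pushing it
  forward along the identity moves it to the \<sigma>-algebra of \<open>M\<close>.\<close>

definition atomic_measure :: "'a measure \<Rightarrow> 'a set \<Rightarrow> ('a \<Rightarrow> real) \<Rightarrow> 'a measure" where
  "atomic_measure M S w = distr (point_measure S (\<lambda>p. ennreal (w p))) M (\<lambda>p. p)"

lemma space_atomic_measure [simp]: "space (atomic_measure M S w) = space M"
  and sets_atomic_measure [simp]: "sets (atomic_measure M S w) = sets M"
  by (simp_all add: atomic_measure_def)

lemma emeasure_atomic_measure:
  assumes "finite S" "S \<subseteq> space M" "\<And>p. p \<in> S \<Longrightarrow> w p \<ge> 0" "A \<in> sets M"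
  shows "emeasure (atomic_measure M S w) A = ennreal (\<Sum>p\<in>S \<inter> A. w p)"
proof -
  have "emeasure (atomic_measure M S w) A = emeasure (point_measure S (\<lambda>p. ennreal (w p))) (S \<inter> A)"
    using assms unfolding atomic_measure_def
    by (subst emeasure_distr) (auto simp: space_point_measure measurable_def sets_point_measure
        Int_commute)
  also have "\<dots> = (\<Sum>p\<in>S \<inter> A. ennreal (w p))"
    using assms by (intro emeasure_point_measure_finite) auto
  also have "\<dots> = ennreal (\<Sum>p\<in>S \<inter> A. w p)" using assms by (intro sum_ennreal) auto
  finally show ?thesis .
qed

lemma integral_atomic_measure:
  assumes "finite S" "S \<subseteq> space M" "\<And>p. p \<in> S \<Longrightarrow> w p \<ge> 0" "f \<in> borel_measurable M"
  shows "integral\<^sup>L (atomic_measure M S w) f = (\<Sum>p\<in>S. w p * f p)"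
  using assms unfolding atomic_measure_def
  by (subst integral_distr) (auto simp: space_point_measure measurable_def sets_point_measure
      lebesgue_integral_point_measure_finite)

text \<open>The supremum over subsets of \<open>A\<close> is attained at the set of atoms in
  \<open>A\<close> with positive weight, which is measurable as a finite union of
  singletons.\<close>

lemma pos_variation_atomic:
  assumes S: "finite S" "S \<subseteq> space M" "\<And>p. p \<in> S \<Longrightarrow> {p} \<in> sets M"
  shows "pos_variation M (\<lambda>A. \<Sum>p\<in>S \<inter> A. w p) = atomic_measure M S (\<lambda>p. max 0 (w p))"
proof -
  let ?N = "atomic_measure M S (\<lambda>p. max 0 (w p))"
  have "(SUP B\<in>{B \<in> sets M. B \<subseteq> A}. ennreal (\<Sum>p\<in>S \<inter> B. w p)) = emeasure ?N A"
    if A: "A \<in> sets M" for A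
  proof -
    have em: "emeasure ?N A = ennreal (\<Sum>p\<in>S \<inter> A. max 0 (w p))"
      using S A by (intro emeasure_atomic_measure) auto
    show ?thesis unfolding em
    proof (rule antisym)
      show "(SUP B\<in>{B \<in> sets M. B \<subseteq> A}. ennreal (\<Sum>p\<in>S \<inter> B. w p))
          \<le> ennreal (\<Sum>p\<in>S \<inter> A. max 0 (w p))"
      proof (intro SUP_least ennreal_leI)
        fix B assume "B \<in> {B \<in> sets M. B \<subseteq> A}"
        have "(\<Sum>p\<in>S \<inter> B. w p) \<le> (\<Sum>p\<in>S \<inter> B. max 0 (w p))" by (intro sum_mono) auto
        also have "\<dots> \<le> (\<Sum>p\<in>S \<inter> A. max 0 (w p))"
          using S \<open>B \<in> _\<close> by (intro sum_mono2) auto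
        finally show "(\<Sum>p\<in>S \<inter> B. w p) \<le> (\<Sum>p\<in>S \<inter> A. max 0 (w p))" .
      qed
      define B where "B = {p \<in> S \<inter> A. w p > 0}"
      have "(\<Union>p\<in>B. {p}) \<in> sets M"
        using S by (intro sets.finite_UN) (auto simp: B_def)
      then have B: "B \<in> sets M" "B \<subseteq> A" by (auto simp: B_def)
      have "(\<Sum>p\<in>S \<inter> A. max 0 (w p)) = (\<Sum>p\<in>S \<inter> B. w p)"
        using S by (intro sum.mono_neutral_cong_right) (auto simp: B_def)
      then show "ennreal (\<Sum>p\<in>S \<inter> A. max 0 (w p))
          \<le> (SUP B\<in>{B \<in> sets M. B \<subseteq> A}. ennreal (\<Sum>p\<in>S \<inter> B. w p))"
        using B by (intro SUP_upper2[of B]) auto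
    qed
  qed
  \<comment> \<open>The supremum agrees on \<open>sets M\<close> with the set function of a genuine
    measure, so \<open>measure_of\<close> gives back that measure.\<close>
  then have "pos_variation M (\<lambda>A. \<Sum>p\<in>S \<inter> A. w p) = measure_of (space M) (sets M) (emeasure ?N)"
    unfolding pos_variation_def
    by (intro measure_of_eq) (auto simp: sets.space_closed sets.sigma_sets_eq)
  also have "\<dots> = ?N"
    using measure_of_of_measure[of ?N] by simp
  finally show ?thesis .
qed

lemma neg_variation_atomic:
  assumes S: "finite S" "S \<subseteq> space M" "\<And>p. p \<in> S \<Longrightarrow> {p} \<in> sets M"
  shows "neg_variation M (\<lambda>A. \<Sum>p\<in>S \<inter> A. w p) = atomic_measure M S (\<lambda>p. max 0 (- w p))"
  using pos_variation_atomic[OF assms, of "\<lambda>p. - w p"] by (simp add: neg_variation_def sum_negf)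

lemma signed_integral_atomic:
  assumes S: "finite S" "S \<subseteq> space M" "\<And>p. p \<in> S \<Longrightarrow> {p} \<in> sets M"
    and f: "f \<in> borel_measurable M"
  shows "signed_integral M (\<lambda>A. \<Sum>p\<in>S \<inter> A. w p) f = (\<Sum>p\<in>S. w p * f p)"
proof -
  have eqs: "pos_variation M (\<lambda>A. \<Sum>p\<in>S \<inter> A. w p) = atomic_measure M S (\<lambda>p. max 0 (w p))"
    "neg_variation M (\<lambda>A. \<Sum>p\<in>S \<inter> A. w p) = atomic_measure M S (\<lambda>p. max 0 (- w p))"
    using S by (auto intro!: pos_variation_atomic neg_variation_atomic)
  show ?thesis
    unfolding signed_integral_def eqs using S f
    by (subst (1 2) integral_atomic_measure)
      (auto simp: sum_subtractf[symmetric] left_diff_distrib[symmetric] max_def intro!: sum.cong)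
qed

lemma TV_norm_atomic:
  assumes S: "finite S" "S \<subseteq> space M" "\<And>p. p \<in> S \<Longrightarrow> {p} \<in> sets M"
  shows "TV_norm M (\<lambda>A. \<Sum>p\<in>S \<inter> A. w p) = (\<Sum>p\<in>S. \<bar>w p\<bar>)"
proof -
  have eqs: "pos_variation M (\<lambda>A. \<Sum>p\<in>S \<inter> A. w p) = atomic_measure M S (\<lambda>p. max 0 (w p))"
    "neg_variation M (\<lambda>A. \<Sum>p\<in>S \<inter> A. w p) = atomic_measure M S (\<lambda>p. max 0 (- w p))"
    using S by (auto intro!: pos_variation_atomic neg_variation_atomic)
  have "S \<inter> space M = S" using S by auto
  then show ?thesis
    unfolding TV_norm_def eqs measure_def using S
    by (subst (1 2) emeasure_atomic_measure)
      (auto simp: sum.distrib[symmetric] sum_nonneg intro!: sum.cong)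
qed

text \<open>In a disjoint family each atom lies in at most one set, so its contribution is a series
  with at most one nonzero term; finitely many such series are added.\<close>

lemma finite_signed_measure_atomic:
  fixes M :: "'a measure"
  assumes S: "finite S"
  shows "finite_signed_measure M (\<lambda>A. \<Sum>p\<in>S \<inter> A. w p)"
proof -
  have "(\<lambda>i. \<Sum>p\<in>S \<inter> A i. w p) sums (\<Sum>p\<in>S \<inter> (\<Union>i. A i). w p)"
    if A: "disjoint_family A" for A :: "nat \<Rightarrow> 'a set"
  proof -
    have single: "(\<lambda>i. if p \<in> A i then w p else 0) sums (if p \<in> (\<Union>i. A i) then w p else 0)" for p
    proof (cases "p \<in> (\<Union>i. A i)")
      case True
      then obtain k where k: "p \<in> A k" by blast
      then have "p \<in> A i \<longleftrightarrow> i = k" for i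
        using A by (auto simp: disjoint_family_on_def)
      then show ?thesis using sums_single[of k "\<lambda>_. w p"] True by simp
    qed auto
    have "(\<lambda>i. \<Sum>p\<in>S. if p \<in> A i then w p else 0) sums
        (\<Sum>p\<in>S. if p \<in> (\<Union>i. A i) then w p else 0)"
      by (intro sums_sum single)
    then show ?thesis using S by (simp add: sum.inter_restrict)
  qed
  then show ?thesis by (auto simp: finite_signed_measure_def)
qed

section \<open>Weighted sums of basis functions\<close>

text \<open>A list may repeat the same basis function, so that concatenation adds both the functions
  and the costs. Repetitions are merged only when measures are built.\<close>

definition atom_sum :: "(real \<times> 'd set \<times> 'd set \<times> 'd thresholds) list \<Rightarrow> real ^ 'd::finite \<Rightarrow> real" where
  "atom_sum as x = (\<Sum>(w, L, U, q)\<leftarrow>as. w * basis_fun L U q x)"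

definition atom_cost :: "(real \<times> 'd set \<times> 'd set \<times> 'd thresholds) list \<Rightarrow> real" where
  "atom_cost as = (\<Sum>(w, L, U, q)\<leftarrow>as. \<bar>w\<bar>)"

lemma atom_sum_simps [simp]:
  "atom_sum [] x = 0"
  "atom_sum ((w, L, U, q) # as) x = w * basis_fun L U q x + atom_sum as x"
  "atom_sum (as @ bs) x = atom_sum as x + atom_sum bs x"
  by (simp_all add: atom_sum_def)

lemma atom_cost_simps [simp]:
  "atom_cost [] = 0"
  "atom_cost ((w, L, U, q) # as) = \<bar>w\<bar> + atom_cost as"
  "atom_cost (as @ bs) = atom_cost as + atom_cost bs"
  by (simp_all add: atom_cost_def)

lemma basis_fun_eq:
  "basis_fun L U (l, u) x = of_bool ((\<forall>j\<in>L. l j \<le> x $ j) \<and> (\<forall>j\<in>U. x $ j < u j))"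
proof -
  have "(\<Prod>j\<in>A. of_bool (P j)) = (of_bool (\<forall>j\<in>A. P j) :: real)" for A :: "'a set" and P
    by (induction A rule: infinite_finite_induct) auto
  then show ?thesis by (simp add: basis_fun_def)
qed

lemma basis_fun_empty [simp]: "basis_fun {} {} q x = 1"
  by (cases q) (simp add: basis_fun_eq)

text \<open>Along a path, several splits at the same coordinate and in the same direction merge into
  one, with the larger lower threshold or the smaller upper threshold.\<close>

lemma basis_fun_add_lower:
  "basis_fun L U (l, u) x * of_bool (x $ j \<ge> t) =
   basis_fun (insert j L) U (l(j := if j \<in> L then max (l j) t else t), u) x"
  by (auto simp: basis_fun_eq)

lemma basis_fun_add_upper:
  "basis_fun L U (l, u) x * of_bool (x $ j < t) =
   basis_fun L (insert j U) (l, u(j := if j \<in> U then min (u j) t else t)) x"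
  by (auto simp: basis_fun_eq)

section \<open>Expansion of trees into their leaves\<close>

text \<open>The box collects the splits passed on the way to a subtree, hence the generalization
  over it. Each leaf yields one atom, and each split enlarges \<open>L\<close> or \<open>U\<close>
  by at most one element. The inclusions later guarantee that the index sets are not both
  empty.\<close>

lemma box_times_tree:
  fixes T :: "'d::finite rtree"
  shows "\<exists>as. (\<forall>(w, L', U', q')\<in>set as. L \<subseteq> L' \<and> U \<subseteq> U' \<and>
                  card L' + card U' \<le> card L + card U + depth T) \<and>
              (\<forall>x. basis_fun L U q x * tree_fun T x = atom_sum as x) \<and>
              atom_cost as = (\<Sum>w\<leftarrow>leaf_weights T. \<bar>w\<bar>)"
proof (induction T arbitrary: L U q)
  case (Leaf w)
  show ?case by (intro exI[of _ "[(w, L, U, q)]"]) simp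
next
  case (Split j t T1 T2)
  obtain l u where q: "q = (l, u)" by (cases q)
  obtain q1 where q1: "\<And>x. basis_fun L U q x * of_bool (x $ j \<ge> t) = basis_fun (insert j L) U q1 x"
    using basis_fun_add_lower q by blast
  obtain q2 where q2: "\<And>x. basis_fun L U q x * of_bool (x $ j < t) = basis_fun L (insert j U) q2 x"
    using basis_fun_add_upper q by blast
  obtain as where as: "\<forall>(w, L', U', q')\<in>set as. insert j L \<subseteq> L' \<and> U \<subseteq> U' \<and>
      card L' + card U' \<le> card (insert j L) + card U + depth T1"
    "\<forall>x. basis_fun (insert j L) U q1 x * tree_fun T1 x = atom_sum as x"
    "atom_cost as = (\<Sum>w\<leftarrow>leaf_weights T1. \<bar>w\<bar>)"
    using Split.IH(1)[of "insert j L" U q1] by blast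
  obtain bs where bs: "\<forall>(w, L', U', q')\<in>set bs. L \<subseteq> L' \<and> insert j U \<subseteq> U' \<and>
      card L' + card U' \<le> card L + card (insert j U) + depth T2"
    "\<forall>x. basis_fun L (insert j U) q2 x * tree_fun T2 x = atom_sum bs x"
    "atom_cost bs = (\<Sum>w\<leftarrow>leaf_weights T2. \<bar>w\<bar>)"
    using Split.IH(2)[of L "insert j U" q2] by blast
  have "card (insert j L) \<le> Suc (card L)" "card (insert j U) \<le> Suc (card U)"
    by (simp_all add: card_insert_if)
  then have "\<forall>(w, L', U', q')\<in>set (as @ bs). L \<subseteq> L' \<and> U \<subseteq> U' \<and>
      card L' + card U' \<le> card L + card U + depth (Split j t T1 T2)"
    using as(1) bs(1) by fastforce
  moreover have "basis_fun L U q x * tree_fun (Split j t T1 T2) x = atom_sum (as @ bs) x" for x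
    using as(2)[rule_format, of x] bs(2)[rule_format, of x]
    by (cases "x $ j \<ge> t") (simp_all add: q1[symmetric] q2[symmetric] not_le)
  ultimately show ?case using as(3) bs(3) by (intro exI[of _ "as @ bs"]) simp
qed

text \<open>A constant tree goes into \<open>c\<close>, matching its zero penalty. Otherwise the
  root split is treated first: every box then contains its coordinate \<open>j\<close>, which gives
  the positivity demanded by \<open>index_pairs\<close>.\<close>

lemma tree_expansion:
  fixes T :: "'d::finite rtree"
  shows "\<exists>c as. (\<forall>(w, L, U, q)\<in>set as. (L, U) \<in> index_pairs (depth T)) \<and>
              (\<forall>x. tree_fun T x = c + atom_sum as x) \<and> atom_cost as = tree_penalty T"
proof (cases T)
  case (Leaf w)
  then show ?thesis by (intro exI[of _ w] exI[of _ "[]"]) (simp add: tree_penalty_def)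
next
  case (Split j t T1 T2)
  define q where "q = (\<lambda>_ :: 'd. t, \<lambda>_ :: 'd. t)"
  have q: "basis_fun {j} {} q x = of_bool (x $ j \<ge> t)" "basis_fun {} {j} q x = of_bool (x $ j < t)" for x
    by (simp_all add: q_def basis_fun_eq)
  obtain as where as: "\<forall>(w, L', U', q')\<in>set as. j \<in> L' \<and>
      card L' + card U' \<le> Suc (depth T1)"
    "\<forall>x. basis_fun {j} {} q x * tree_fun T1 x = atom_sum as x"
    "atom_cost as = (\<Sum>w\<leftarrow>leaf_weights T1. \<bar>w\<bar>)"
    using box_times_tree[of "{j}" "{}" T1 q] by auto
  obtain bs where bs: "\<forall>(w, L', U', q')\<in>set bs. j \<in> U' \<and>
      card L' + card U' \<le> Suc (depth T2)"
    "\<forall>x. basis_fun {} {j} q x * tree_fun T2 x = atom_sum bs x"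
    "atom_cost bs = (\<Sum>w\<leftarrow>leaf_weights T2. \<bar>w\<bar>)"
    using box_times_tree[of "{}" "{j}" T2 q] by auto
  have pos: "card A > 0" if "j \<in> A" for A :: "'d set"
    using that by (auto simp: card_gt_0_iff)
  have "\<forall>(w, L, U, q)\<in>set (as @ bs). (L, U) \<in> index_pairs (depth T)"
    using as(1) bs(1) by (fastforce simp: index_pairs_def Split dest: pos)
  moreover have "tree_fun T x = 0 + atom_sum (as @ bs) x" for x
    using as(2)[rule_format, of x] bs(2)[rule_format, of x]
    by (cases "x $ j \<ge> t") (simp_all add: q Split not_le)
  ultimately show ?thesis using as(3) bs(3) Split
    by (intro exI[of _ 0] exI[of _ "as @ bs"]) (simp add: tree_penalty_def)
qed

lemma index_pairs_mono: "m \<le> s \<Longrightarrow> index_pairs m \<subseteq> index_pairs s"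
  by (auto simp: index_pairs_def)

lemma tree_sum_expansion:
  fixes Ts :: "'d::finite rtree list"
  assumes "\<forall>T\<in>set Ts. depth T \<le> s"
  shows "\<exists>c as. (\<forall>(w, L, U, q)\<in>set as. (L, U) \<in> index_pairs s) \<and>
              (\<forall>x. (\<Sum>T\<leftarrow>Ts. tree_fun T x) = c + atom_sum as x) \<and>
              atom_cost as = (\<Sum>T\<leftarrow>Ts. tree_penalty T)"
  using assms
proof (induction Ts)
  case Nil
  show ?case by (intro exI[of _ 0] exI[of _ "[]"]) simp
next
  case (Cons T Ts)
  obtain c as where as: "\<forall>(w, L, U, q)\<in>set as. (L, U) \<in> index_pairs s"
    "\<forall>x. (\<Sum>T\<leftarrow>Ts. tree_fun T x) = c + atom_sum as x"
    "atom_cost as = (\<Sum>T\<leftarrow>Ts. tree_penalty T)"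
    using Cons by auto
  obtain c' bs where bs: "\<forall>(w, L, U, q)\<in>set bs. (L, U) \<in> index_pairs (depth T)"
    "\<forall>x. tree_fun T x = c' + atom_sum bs x" "atom_cost bs = tree_penalty T"
    using tree_expansion[of T] by blast
  have "\<forall>(w, L, U, q)\<in>set (as @ bs). (L, U) \<in> index_pairs s"
    using as(1) bs(1) index_pairs_mono[of "depth T" s] Cons.prems by fastforce
  then show ?case using as bs
    by (intro exI[of _ "c + c'"] exI[of _ "as @ bs"]) simp
qed

section \<open>Realization of basis functions by trees\<close>

text \<open>The tree is a chain of splits in which every failed condition ends in a leaf of weight
  0, so \<open>w\<close> is the only weight that can be nonzero.\<close>

lemma basis_fun_upper_tree:
  fixes U :: "'d::finite set"
  shows "\<exists>T. depth T = card U \<and> (\<forall>x. tree_fun T x = w * basis_fun {} U (l, u) x) \<and>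
             (\<Sum>v\<leftarrow>leaf_weights T. \<bar>v\<bar>) = \<bar>w\<bar>"
proof (induction U rule: finite_induct[OF finite])
  case 1
  show ?case by (intro exI[of _ "Leaf w"]) simp
next
  case (2 j U)
  then obtain T where "depth T = card U" "\<forall>x. tree_fun T x = w * basis_fun {} U (l, u) x"
    "(\<Sum>v\<leftarrow>leaf_weights T. \<bar>v\<bar>) = \<bar>w\<bar>"
    by blast
  with 2 show ?case
    by (intro exI[of _ "Split j (u j) (Leaf 0) T"]) (auto simp: basis_fun_eq)
qed

text \<open>The chain for \<open>U\<close> is extended by one split per element of \<open>L\<close>.
  A coordinate in both sets is split twice, so the depth is exactly
  \<open>card L + card U\<close>.\<close>

lemma basis_fun_tree:
  fixes L U :: "'d::finite set"
  shows "\<exists>T. depth T = card L + card U \<and> (\<forall>x. tree_fun T x = w * basis_fun L U (l, u) x) \<and>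
             (\<Sum>v\<leftarrow>leaf_weights T. \<bar>v\<bar>) = \<bar>w\<bar>"
proof (induction L rule: finite_induct[OF finite])
  case 1
  show ?case using basis_fun_upper_tree[of U w l u] by simp
next
  case (2 j L)
  then obtain T where "depth T = card L + card U" "\<forall>x. tree_fun T x = w * basis_fun L U (l, u) x"
    "(\<Sum>v\<leftarrow>leaf_weights T. \<bar>v\<bar>) = \<bar>w\<bar>"
    by blast
  with 2 show ?case
    by (intro exI[of _ "Split j (l j) T (Leaf 0)"]) (auto simp: basis_fun_eq)
qed

text \<open>Each atom becomes one tree. Its depth is positive because the index sets are not both
  empty, so the convention for constant trees does not apply and its penalty is exactly the absolute
  weight.\<close>

lemma atoms_trees:
  fixes as :: "(real \<times> 'd::finite set \<times> 'd set \<times> 'd thresholds) list"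
  assumes "\<forall>(w, L, U, q)\<in>set as. (L, U) \<in> index_pairs s"
  shows "\<exists>Ts. (\<forall>T\<in>set Ts. depth T \<le> s) \<and> (\<forall>x. (\<Sum>T\<leftarrow>Ts. tree_fun T x) = atom_sum as x) \<and>
              (\<Sum>T\<leftarrow>Ts. tree_penalty T) = atom_cost as"
  using assms
proof (induction as)
  case Nil
  show ?case by (intro exI[of _ "[]"]) simp
next
  case (Cons a as)
  obtain w L U l u where a: "a = (w, L, U, l, u)" by (metis prod.exhaust)
  obtain Ts where Ts: "\<forall>T\<in>set Ts. depth T \<le> s" "\<forall>x. (\<Sum>T\<leftarrow>Ts. tree_fun T x) = atom_sum as x"
    "(\<Sum>T\<leftarrow>Ts. tree_penalty T) = atom_cost as"
    using Cons by auto
  obtain T where T: "depth T = card L + card U" "\<forall>x. tree_fun T x = w * basis_fun L U (l, u) x"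
    "(\<Sum>v\<leftarrow>leaf_weights T. \<bar>v\<bar>) = \<bar>w\<bar>"
    using basis_fun_tree by blast
  have "(L, U) \<in> index_pairs s" using Cons.prems a by simp
  with Ts T show ?case
    by (intro exI[of _ "T # Ts"]) (auto simp: a index_pairs_def tree_penalty_def)
qed

lemma F_ST_atom_sum:
  fixes as :: "(real \<times> 'd::finite set \<times> 'd set \<times> 'd thresholds) list"
  assumes "\<forall>(w, L, U, q)\<in>set as. (L, U) \<in> index_pairs s"
  shows "(\<lambda>x. c + atom_sum as x) \<in> F_ST s" "V_XGB s (\<lambda>x. c + atom_sum as x) \<le> atom_cost as"
proof -
  obtain Ts where Ts: "\<forall>T\<in>set Ts. depth T \<le> s" "\<forall>x. (\<Sum>T\<leftarrow>Ts. tree_fun T x) = atom_sum as x"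
    "(\<Sum>T\<leftarrow>Ts. tree_penalty T) = atom_cost as"
    using atoms_trees[OF assms] by blast
  \<comment> \<open>The extra leaf supplies the constant at no cost and keeps the list nonempty even
    when there are no atoms.\<close>
  have rep: "ST_rep s (Leaf c # Ts) (\<lambda>x. c + atom_sum as x)"
    using Ts by (simp add: ST_rep_def)
  then show "(\<lambda>x. c + atom_sum as x) \<in> F_ST s" by (auto simp: F_ST_def)
  have "(\<Sum>T\<leftarrow>Leaf c # Ts. tree_penalty T) = atom_cost as"
    using Ts by (simp add: tree_penalty_def)
  moreover have "bdd_below {\<Sum>T\<leftarrow>Ts. tree_penalty T | Ts. ST_rep s Ts (\<lambda>x. c + atom_sum as x)}"
  proof (intro bdd_belowI[of _ 0])
    fix v assume "v \<in> {\<Sum>T\<leftarrow>Ts. tree_penalty T | Ts. ST_rep s Ts (\<lambda>x. c + atom_sum as x)}"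
    then show "0 \<le> v" by (auto simp: tree_penalty_def intro!: sum_list_nonneg)
  qed
  ultimately show "V_XGB s (\<lambda>x. c + atom_sum as x) \<le> atom_cost as"
    unfolding V_XGB_def using rep by (intro cInf_lower) (metis (mono_tags, lifting) mem_Collect_eq)
qed

section \<open>Threshold spaces\<close>

text \<open>Points of \<open>thr_space L U\<close> are undefined outside \<open>L\<close> and
  \<open>U\<close>, whereas the thresholds of an atom are arbitrary functions. Restriction moves
  them into the space without changing the basis function.\<close>

definition thr_restrict :: "'d set \<Rightarrow> 'd set \<Rightarrow> 'd thresholds \<Rightarrow> 'd thresholds" where
  "thr_restrict L U = (\<lambda>(l, u). (restrict l L, restrict u U))"

lemma thr_restrict_in_space: "thr_restrict L U q \<in> space (thr_space L U)"
  by (cases q) (auto simp: thr_restrict_def thr_space_def space_pair_measure space_PiM)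

lemma basis_fun_thr_restrict [simp]: "basis_fun L U (thr_restrict L U q) x = basis_fun L U q x"
  by (cases q) (simp add: thr_restrict_def basis_fun_eq)

lemma singleton_in_sets_thr_space:
  fixes L U :: "'d::finite set"
  assumes "p \<in> space (thr_space L U)"
  shows "{p} \<in> sets (thr_space L U)"
proof -
  obtain l u where p: "p = (l, u)" by (cases p)
  have sing: "{l} \<in> sets (\<Pi>\<^sub>M j\<in>A. borel)" if "l \<in> space (\<Pi>\<^sub>M j\<in>A. borel)"
    for l :: "'d \<Rightarrow> real" and A
  proof -
    have "{l} = (\<Pi>\<^sub>E j\<in>A. {l j})" using that by (auto simp: space_PiM PiE_singleton PiE_iff)
    also have "\<dots> \<in> sets (\<Pi>\<^sub>M j\<in>A. borel)" by (intro sets_PiM_I_finite) auto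
    finally show ?thesis .
  qed
  have "{l} \<times> {u} \<in> sets (thr_space L U)"
    using assms unfolding thr_space_def p
    by (intro pair_measureI sing) (auto simp: space_pair_measure)
  then show ?thesis by (simp add: p)
qed

lemma measurable_basis_fun [measurable]:
  "(\<lambda>q. basis_fun L U q x) \<in> borel_measurable (thr_space L U)"
proof -
  have [measurable]: "(\<lambda>q. fst q j) \<in> borel_measurable (thr_space L U)" if "j \<in> L" for j
    using that unfolding thr_space_def by measurable
  have [measurable]: "(\<lambda>q. snd q j) \<in> borel_measurable (thr_space L U)" if "j \<in> U" for j
    using that unfolding thr_space_def by measurable
  show ?thesis unfolding basis_fun_def case_prod_beta
    by (intro borel_measurable_times borel_measurable_prod) (simp_all add: of_bool_def)
qed

section \<open>Weighted sums of basis functions in the extended class\<close>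

lemma sum_list_group:
  fixes g :: "'k \<Rightarrow> real"
  assumes "finite K" "\<forall>(w, k)\<in>set xs. k \<in> K"
  shows "(\<Sum>k\<in>K. (\<Sum>(w, k')\<leftarrow>xs. if k' = k then w else 0) * g k) = (\<Sum>(w, k)\<leftarrow>xs. w * g k)"
  using assms(2)
proof (induction xs)
  case (Cons a xs)
  obtain v k where a: "a = (v, k)" by (cases a)
  have "(\<Sum>k'\<in>K. (if k = k' then v else 0) * g k') = v * g k"
    using Cons.prems assms(1) by (simp add: a if_distrib[of "\<lambda>r. r * _"] cong: if_cong)
  then show ?case using Cons by (simp add: a distrib_right sum.distrib)
qed simp

text \<open>Merging the weights that share a key can only cause cancellation, by the triangle
  inequality.\<close>

lemma sum_list_group_abs:
  fixes xs :: "(real \<times> 'k) list"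
  assumes "finite K" "\<forall>(w, k)\<in>set xs. k \<in> K"
  shows "(\<Sum>k\<in>K. \<bar>\<Sum>(w, k')\<leftarrow>xs. if k' = k then w else 0\<bar>) \<le> (\<Sum>(w, k)\<leftarrow>xs. \<bar>w\<bar>)"
  using assms(2)
proof (induction xs)
  case (Cons a xs)
  obtain v k where a: "a = (v, k)" by (cases a)
  let ?r = "\<lambda>k. \<Sum>(w, k')\<leftarrow>xs. if k' = k then w else 0"
  have "(\<Sum>k'\<in>K. \<bar>(if k = k' then v else 0) + ?r k'\<bar>)
      \<le> (\<Sum>k'\<in>K. (if k = k' then \<bar>v\<bar> else 0) + \<bar>?r k'\<bar>)"
    by (intro sum_mono) auto
  also have "\<dots> = \<bar>v\<bar> + (\<Sum>k'\<in>K. \<bar>?r k'\<bar>)"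
    using Cons.prems assms(1) by (simp add: a sum.distrib)
  also have "\<dots> \<le> \<bar>v\<bar> + (\<Sum>(w, k)\<leftarrow>xs. \<bar>w\<bar>)" using Cons by simp
  finally show ?case by (simp add: a)
qed simp

text \<open>The atoms, grouped by \<open>(L, U)\<close>, are the point masses of discrete signed
  measures. Merging equal atoms is what makes the cost bound an inequality.\<close>

lemma F_inf_ST_atom_sum:
  fixes as :: "(real \<times> 'd::finite set \<times> 'd set \<times> 'd thresholds) list"
  assumes "\<forall>(w, L, U, q)\<in>set as. (L, U) \<in> index_pairs s"
  shows "(\<lambda>x. c + atom_sum as x) \<in> F_inf_ST s" "V_inf_XGB s (\<lambda>x. c + atom_sum as x) \<le> atom_cost as"
proof -
  define xs where "xs = map (\<lambda>(w, L, U, q). (w, (L, U), thr_restrict L U q)) as"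
  \<comment> \<open>The key of an atom is \<open>((L, U), q)\<close>. \<open>S L U\<close> is the
    support of the measure for \<open>(L, U)\<close>, \<open>W\<close> the merged weight of a key,
    and \<open>K\<close> the set of all keys.\<close>
  define S where "S L U = {q. ((L, U), q) \<in> snd ` set xs}" for L U
  define W where "W k = (\<Sum>(w, k')\<leftarrow>xs. if k' = k then w else 0)" for k
  define \<nu> where "\<nu> L U A = (\<Sum>q\<in>S L U \<inter> A. W ((L, U), q))" for L U A
  define K where "K = Sigma (index_pairs s) (\<lambda>(L, U). S L U)"
  have fin_I: "finite (index_pairs s :: ('d set \<times> 'd set) set)" by simp
  have fin_S: "finite (S L U)" for L U
  proof -
    have "S L U \<subseteq> snd ` snd ` set xs" by (force simp: S_def)
    then show ?thesis by (rule finite_subset) simp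
  qed
  have S: "S L U \<subseteq> space (thr_space L U)" "\<And>p. p \<in> S L U \<Longrightarrow> {p} \<in> sets (thr_space L U)" for L U
    by (auto simp: S_def xs_def thr_restrict_in_space intro!: singleton_in_sets_thr_space)
  have fin_K: "finite K" unfolding K_def using fin_S by (intro finite_SigmaI fin_I) auto
  have xs_K: "\<forall>(w, k)\<in>set xs. k \<in> K"
    using assms by (force simp: K_def S_def xs_def)
  have sum_K: "(\<Sum>(L, U)\<in>index_pairs s. \<Sum>q\<in>S L U. h ((L, U), q)) = sum h K" for h :: "_ \<Rightarrow> real"
    unfolding K_def split_beta using fin_I fin_S by (subst sum.Sigma) (auto simp: split_beta)
  have "inf_ST_fun s c \<nu> x = c + atom_sum as x" for x
  proof -
    have "(\<Sum>(L, U)\<in>index_pairs s.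
          signed_integral (thr_space L U) (\<nu> L U) (\<lambda>lu. basis_fun L U lu x)) =
        (\<Sum>(L, U)\<in>index_pairs s. \<Sum>q\<in>S L U. W ((L, U), q) * basis_fun L U q x)"
    proof (intro sum.cong refl, clarify)
      fix L U :: "'d set"
      show "signed_integral (thr_space L U) (\<nu> L U) (\<lambda>lu. basis_fun L U lu x) =
          (\<Sum>q\<in>S L U. W ((L, U), q) * basis_fun L U q x)"
        unfolding \<nu>_def by (rule signed_integral_atomic[OF fin_S S measurable_basis_fun])
    qed
    also have "\<dots> = (\<Sum>k\<in>K. W k * (\<lambda>((L, U), q). basis_fun L U q x) k)"
      using sum_K[of "\<lambda>k. W k * (\<lambda>((L, U), q). basis_fun L U q x) k"] by simp
    also have "\<dots> = (\<Sum>(w, k)\<leftarrow>xs. w * (\<lambda>((L, U), q). basis_fun L U q x) k)"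
      unfolding W_def by (rule sum_list_group[OF fin_K xs_K])
    also have "\<dots> = atom_sum as x"
      by (auto simp: xs_def atom_sum_def o_def split_beta intro!: arg_cong[where f=sum_list])
    finally show ?thesis by (simp add: inf_ST_fun_def)
  qed
  then have rep: "inf_ST_rep s c \<nu> (\<lambda>x. c + atom_sum as x)"
    unfolding inf_ST_rep_def \<nu>_def using finite_signed_measure_atomic[OF fin_S] by auto
  then show "(\<lambda>x. c + atom_sum as x) \<in> F_inf_ST s" by (auto simp: F_inf_ST_def)
  have "V_inf_XGB s (\<lambda>x. c + atom_sum as x)
      \<le> (\<Sum>(L, U)\<in>index_pairs s. TV_norm (thr_space L U) (\<nu> L U))"
    unfolding V_inf_XGB_def
  proof (rule cInf_lower)
    show "bdd_below {\<Sum>(L, U)\<in>index_pairs s. TV_norm (thr_space L U) (\<nu> L U) |c' \<nu>.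
        inf_ST_rep s c' \<nu> (\<lambda>x. c + atom_sum as x)}"
      by (intro bdd_belowI[of _ 0]) (auto intro!: sum_nonneg TV_norm_nonneg)
  qed (use rep in blast)
  also have "\<dots> = (\<Sum>(L, U)\<in>index_pairs s. \<Sum>q\<in>S L U. \<bar>W ((L, U), q)\<bar>)"
  proof (intro sum.cong refl, clarify)
    fix L U :: "'d set"
    show "TV_norm (thr_space L U) (\<nu> L U) = (\<Sum>q\<in>S L U. \<bar>W ((L, U), q)\<bar>)"
      unfolding \<nu>_def by (rule TV_norm_atomic[OF fin_S S])
  qed
  also have "\<dots> = (\<Sum>k\<in>K. \<bar>W k\<bar>)" by (rule sum_K)
  also have "\<dots> \<le> (\<Sum>(w, k)\<leftarrow>xs. \<bar>w\<bar>)"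
    unfolding W_def by (rule sum_list_group_abs[OF fin_K xs_K])
  also have "\<dots> = atom_cost as"
    by (auto simp: xs_def atom_cost_def o_def split_beta intro!: arg_cong[where f=sum_list])
  finally show "V_inf_XGB s (\<lambda>x. c + atom_sum as x) \<le> atom_cost as" .
qed

text \<open>Expansion into leaves turns every tree representation into atoms of the same cost; the
  bound then passes to the infimum over tree representations.\<close>

lemma F_ST_subset_F_inf_ST:
  assumes "f \<in> F_ST s"
  shows "f \<in> F_inf_ST s" "V_inf_XGB s f \<le> V_XGB s f"
proof -
  have *: "f \<in> F_inf_ST s \<and> V_inf_XGB s f \<le> (\<Sum>T\<leftarrow>Ts. tree_penalty T)" if "ST_rep s Ts f" for Ts
  proof -
    have "\<forall>T\<in>set Ts. depth T \<le> s" and f: "f = (\<lambda>x. \<Sum>T\<leftarrow>Ts. tree_fun T x)"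
      using that by (simp_all add: ST_rep_def)
    then obtain c as where as: "\<forall>(w, L, U, q)\<in>set as. (L, U) \<in> index_pairs s"
      "\<forall>x. (\<Sum>T\<leftarrow>Ts. tree_fun T x) = c + atom_sum as x"
      "atom_cost as = (\<Sum>T\<leftarrow>Ts. tree_penalty T)"
      using tree_sum_expansion[of Ts s] by blast
    then have "f = (\<lambda>x. c + atom_sum as x)" using f by simp
    then show ?thesis using F_inf_ST_atom_sum[OF as(1), of c] as(3) by simp
  qed
  obtain Ts where Ts: "ST_rep s Ts f" using assms by (auto simp: F_ST_def)
  with * show "f \<in> F_inf_ST s" by blast
  show "V_inf_XGB s f \<le> V_XGB s f"
    unfolding V_XGB_def using Ts * by (intro cInf_greatest) auto
qed

section \<open>Reduction to finitely many patterns on the data\<close>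

definition pattern ::
    "nat \<Rightarrow> (nat \<Rightarrow> real ^ 'd::finite) \<Rightarrow> 'd set \<Rightarrow> 'd set \<Rightarrow> 'd thresholds \<Rightarrow> nat set" where
  "pattern n x L U q = {i \<in> {1..n}. basis_fun L U q (x i) = 1}"

text \<open>Patterns from different \<open>(L, U)\<close> are identified, so each needs only one
  weight. Every member comes with some \<open>(L, U, q)\<close>, from which a basis function
  realizing it can be chosen.\<close>

definition patterns :: "nat \<Rightarrow> nat \<Rightarrow> (nat \<Rightarrow> real ^ 'd::finite) \<Rightarrow> nat set set" where
  "patterns s n x = {pattern n x L U q | L U q. (L, U) \<in> index_pairs s}"

lemma finite_patterns: "finite (patterns s n x)"
proof -
  have "patterns s n x \<subseteq> Pow {1..n}" by (auto simp: patterns_def pattern_def)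
  then show ?thesis by (rule finite_subset) simp
qed

lemma basis_fun_pattern:
  assumes "i \<in> {1..n}"
  shows "basis_fun L U q (x i) = of_bool (i \<in> pattern n x L U q)"
  using assms by (cases q) (auto simp: pattern_def basis_fun_eq)

text \<open>Fixing the pattern means fixing the values of finitely many measurable basis functions.
  A \<open>P\<close> with indices outside the data is no pattern and gives the empty set.\<close>

lemma sets_pattern: "{q \<in> space (thr_space L U). pattern n x L U q = P} \<in> sets (thr_space L U)"
proof (cases "P \<subseteq> {1..n}")
  case True
  have "pattern n x L U q = P \<longleftrightarrow> (\<forall>i\<in>{1..n}. basis_fun L U q (x i) = of_bool (i \<in> P))" for q
  proof -
    have "(\<forall>i\<in>{1..n}. basis_fun L U q (x i) = of_bool (i \<in> P)) \<longleftrightarrow>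
        (\<forall>i\<in>{1..n}. i \<in> pattern n x L U q \<longleftrightarrow> i \<in> P)"
      by (intro ball_cong refl) (simp only: basis_fun_pattern of_bool_eq_iff)
    also have "\<dots> \<longleftrightarrow> pattern n x L U q = P"
      using True unfolding pattern_def by blast
    finally show ?thesis ..
  qed
  then have "{q \<in> space (thr_space L U). pattern n x L U q = P} =
    {q \<in> space (thr_space L U). \<forall>i\<in>{1..n}. basis_fun L U q (x i) = of_bool (i \<in> P)}"
    by simp
  also have "\<dots> \<in> sets (thr_space L U)" by measurable
  finally show ?thesis .
next
  case False
  then have "{q \<in> space (thr_space L U). pattern n x L U q = P} = {}"
    by (auto simp: pattern_def)
  then show ?thesis by (simp only: sets.empty_sets)
qed

text \<open>At a data point the integrand is constant on each cell of thresholds with equal pattern,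
  so only the masses of the cells matter. The cells partition the threshold space, and the triangle
  inequality bounds the net masses by the total variation.\<close>

lemma inf_ST_rep_on_data:
  fixes x :: "nat \<Rightarrow> real ^ 'd::finite"
  assumes rep: "inf_ST_rep s c \<nu> f"
  shows "\<exists>w. (\<forall>i\<in>{1..n}. f (x i) = c + (\<Sum>P\<in>patterns s n x. w P * of_bool (i \<in> P))) \<and>
    (\<Sum>P\<in>patterns s n x. \<bar>w P\<bar>) \<le> (\<Sum>(L, U)\<in>index_pairs s. TV_norm (thr_space L U) (\<nu> L U))"
proof -
  let ?R = "patterns s n x"
  define A where "A L U P = {q \<in> space (thr_space L U). pattern n x L U q = P}" for L U P
  define pos where "pos L U P = measure (pos_variation (thr_space L U) (\<nu> L U)) (A L U P)" for L U P
  define neg where "neg L U P = measure (neg_variation (thr_space L U) (\<nu> L U)) (A L U P)" for L U P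
  \<comment> \<open>\<open>w P\<close> is the net mass of all thresholds with pattern
    \<open>P\<close>, accumulated over all index pairs.\<close>
  define w where "w P = (\<Sum>(L, U)\<in>index_pairs s. pos L U P - neg L U P)" for P
  have integral: "integral\<^sup>L N (\<lambda>q. g (pattern n x L U q)) = (\<Sum>P\<in>?R. g P * measure N (A L U P))"
    if "(L, U) \<in> index_pairs s" "finite_measure N" "sets N = sets (thr_space L U)"
    for N L U and g :: "_ \<Rightarrow> real"
  proof -
    have sp: "space N = space (thr_space L U)" using that(3) by (rule sets_eq_imp_space_eq)
    show ?thesis unfolding A_def sp[symmetric]
      using that finite_patterns
      by (intro integral_finite_range) (auto simp: patterns_def sp sets_pattern)
  qed
  have fsm: "finite_signed_measure (thr_space L U) (\<nu> L U)" if "(L, U) \<in> index_pairs s" for L U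
    using rep that by (auto simp: inf_ST_rep_def)
  have int_pos: "integral\<^sup>L (pos_variation (thr_space L U) (\<nu> L U)) (\<lambda>q. g (pattern n x L U q)) =
      (\<Sum>P\<in>?R. g P * pos L U P)"
    and int_neg: "integral\<^sup>L (neg_variation (thr_space L U) (\<nu> L U)) (\<lambda>q. g (pattern n x L U q)) =
      (\<Sum>P\<in>?R. g P * neg L U P)"
    if "(L, U) \<in> index_pairs s" for L U and g :: "_ \<Rightarrow> real"
    unfolding pos_def neg_def using fsm[OF that] that
    by (auto intro!: integral finite_measure_pos_variation finite_measure_neg_variation)
  have "f (x i) = c + (\<Sum>P\<in>?R. w P * of_bool (i \<in> P))" if i: "i \<in> {1..n}" for i
  proof -
    have "signed_integral (thr_space L U) (\<nu> L U) (\<lambda>q. basis_fun L U q (x i)) =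
        (\<Sum>P\<in>?R. (pos L U P - neg L U P) * of_bool (i \<in> P))" if "(L, U) \<in> index_pairs s" for L U
      unfolding signed_integral_def basis_fun_pattern[OF i]
      using int_pos[OF that, of "\<lambda>P. of_bool (i \<in> P)"] int_neg[OF that, of "\<lambda>P. of_bool (i \<in> P)"]
      by (simp add: sum_subtractf[symmetric] algebra_simps)
    then have "f (x i) = c + (\<Sum>(L, U)\<in>index_pairs s. \<Sum>P\<in>?R. (pos L U P - neg L U P) * of_bool (i \<in> P))"
      using rep by (auto simp: inf_ST_rep_def inf_ST_fun_def intro!: sum.cong)
    also have "(\<Sum>(L, U)\<in>index_pairs s. \<Sum>P\<in>?R. (pos L U P - neg L U P) * of_bool (i \<in> P)) =
        (\<Sum>P\<in>?R. w P * of_bool (i \<in> P))"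
      unfolding w_def split_beta sum_distrib_right by (rule sum.swap)
    finally show ?thesis .
  qed
  moreover have "(\<Sum>P\<in>?R. \<bar>w P\<bar>) \<le> (\<Sum>(L, U)\<in>index_pairs s. TV_norm (thr_space L U) (\<nu> L U))"
  proof -
    have "(\<Sum>P\<in>?R. \<bar>w P\<bar>) \<le> (\<Sum>P\<in>?R. \<Sum>(L, U)\<in>index_pairs s. pos L U P + neg L U P)"
      unfolding w_def
      by (intro sum_mono order_trans[OF sum_abs]) (auto intro!: sum_mono simp: pos_def neg_def abs_le_iff)
    also have "\<dots> = (\<Sum>(L, U)\<in>index_pairs s. \<Sum>P\<in>?R. pos L U P + neg L U P)"
      unfolding split_beta by (rule sum.swap)
    also have "\<dots> = (\<Sum>(L, U)\<in>index_pairs s. TV_norm (thr_space L U) (\<nu> L U))"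
    proof (intro sum.cong refl, clarify)
      fix L U :: "'d set" assume LU: "(L, U) \<in> index_pairs s"
      show "(\<Sum>P\<in>?R. pos L U P + neg L U P) = TV_norm (thr_space L U) (\<nu> L U)"
        \<comment> \<open>For \<open>g = 1\<close> the integrals are the total masses of the two
          variations.\<close>
        using int_pos[OF LU, of "\<lambda>_. 1"] int_neg[OF LU, of "\<lambda>_. 1"]
        by (simp add: TV_norm_def sum.distrib)
    qed
    finally show ?thesis .
  qed
  ultimately show ?thesis by blast
qed

section \<open>Finite-dimensional minimization\<close>

text \<open>Points no worse than the origin can be moved into a compact box without changing the
  objective, and a continuous function attains its minimum there.\<close>

lemma l1_least_squares_attains_min:
  fixes a :: "nat \<Rightarrow> 'p \<Rightarrow> real" and y :: "nat \<Rightarrow> real"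
  assumes R: "finite R" and "n \<ge> 1" "\<alpha> > 0" and a: "\<And>i p. \<bar>a i p\<bar> \<le> 1"
  defines "\<Phi> \<equiv> \<lambda>c w. (\<Sum>i=1..n. (y i - (c + (\<Sum>p\<in>R. w p * a i p)))\<^sup>2) + \<alpha> * (\<Sum>p\<in>R. \<bar>w p\<bar>)"
  shows "\<exists>c w. \<forall>c' w'. \<Phi> c w \<le> \<Phi> c' w'"
proof -
  \<comment> \<open>An objective value at most \<open>M\<close> forces the \<alpha>-weighted penalty
    below \<open>M\<close>, hence each weight into \<open>[-B, B]\<close>. The unpenalized
    \<open>c\<close> is controlled by the first residual, at most \<open>sqrt M\<close>, together
    with a prediction term of size at most \<open>B\<close>.\<close>
  define M where "M = \<Phi> 0 (\<lambda>_. 0)"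
  define B where "B = M / \<alpha>"
  define C where "C = \<bar>y 1\<bar> + sqrt M + B"
  \<comment> \<open>Weights are functions on the whole type; fixing them to 0 outside
    \<open>R\<close> lets Tychonoff give compactness.\<close>
  define S where "S p = (if p \<in> R then {-B..B} else {0})" for p
  define K where "K = {-C..C} \<times> Pi\<^sub>E UNIV S"
  have "M \<ge> 0" by (simp add: M_def \<Phi>_def sum_nonneg)
  then have "B \<ge> 0" "C \<ge> 0" using \<open>\<alpha> > 0\<close> by (simp_all add: B_def C_def)
  have "compactin (product_topology (\<lambda>p. euclidean) UNIV) (Pi\<^sub>E UNIV S)"
    by (subst compactin_PiE) (auto simp: S_def)
  then have "compact (Pi\<^sub>E UNIV S)"
    by (simp add: euclidean_product_topology)
  then have "compact K" unfolding K_def by (intro compact_Times) auto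
  moreover have "(0, \<lambda>_. 0) \<in> K"
    using \<open>B \<ge> 0\<close> \<open>C \<ge> 0\<close> by (auto simp: K_def S_def)
  moreover have "continuous_on K (\<lambda>z. \<Phi> (fst z) (snd z))"
  proof -
    have "continuous_on K (\<lambda>z. snd z p)" for p
      by (rule continuous_on_compose2[OF continuous_on_product_coordinates continuous_on_snd])
        (auto intro: continuous_on_id)
    then show ?thesis unfolding \<Phi>_def by (intro continuous_intros)
  qed
  ultimately obtain z where z: "z \<in> K" "\<forall>z'\<in>K. \<Phi> (fst z) (snd z) \<le> \<Phi> (fst z') (snd z')"
    using continuous_attains_inf[of K] by blast
  have "\<Phi> (fst z) (snd z) \<le> \<Phi> c w" for c w
  proof (cases "\<Phi> c w \<le> M")
    case True
    define w' where "w' p = (if p \<in> R then w p else 0)" for p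
    have \<Phi>_w': "\<Phi> c w' = \<Phi> c w" by (simp add: \<Phi>_def w'_def)
    have "\<alpha> * (\<Sum>p\<in>R. \<bar>w p\<bar>) \<le> \<Phi> c w" by (simp add: \<Phi>_def sum_nonneg)
    then have w: "(\<Sum>p\<in>R. \<bar>w p\<bar>) \<le> B"
      using True \<open>\<alpha> > 0\<close> by (simp add: B_def pos_le_divide_eq mult.commute)
    have "\<bar>w p\<bar> \<le> B" if "p \<in> R" for p
      using member_le_sum[of p R "\<lambda>p. \<bar>w p\<bar>"] R that w by simp
    then have "w' \<in> Pi\<^sub>E UNIV S" by (auto simp: w'_def S_def abs_le_iff) fastforce
    let ?s = "\<Sum>p\<in>R. w p * a 1 p"
    have "\<bar>?s\<bar> \<le> (\<Sum>p\<in>R. \<bar>w p\<bar>)"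
      by (rule order_trans[OF sum_abs]) (intro sum_mono, simp add: abs_mult a mult_left_le)
    then have s: "\<bar>?s\<bar> \<le> B" using w by linarith
    have "(y 1 - (c + ?s))\<^sup>2 \<le> (\<Sum>i=1..n. (y i - (c + (\<Sum>p\<in>R. w p * a i p)))\<^sup>2)"
      using \<open>n \<ge> 1\<close> by (intro member_le_sum) auto
    also have "\<dots> \<le> \<Phi> c w" using \<open>\<alpha> > 0\<close> by (simp add: \<Phi>_def sum_nonneg)
    finally have "(y 1 - (c + ?s))\<^sup>2 \<le> M" using True by linarith
    then have "\<bar>y 1 - (c + ?s)\<bar> \<le> sqrt M" by (metis real_sqrt_abs real_sqrt_le_mono)
    then have "c \<in> {-C..C}" using s unfolding C_def by auto
    with \<open>w' \<in> _\<close> have "(c, w') \<in> K" by (simp add: K_def)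
    then show ?thesis using z(2) \<Phi>_w' by fastforce
  next
    case False
    have "\<Phi> (fst z) (snd z) \<le> M"
      using z(2) \<open>(0, \<lambda>_. 0) \<in> K\<close> by (fastforce simp: M_def)
    then show ?thesis using False by linarith
  qed
  then show ?thesis by blast
qed

section \<open>Comparison of the two problems\<close>

theorem theorem2:
  fixes s n :: nat and x :: "nat \<Rightarrow> real ^ 'd::finite" and y :: "nat \<Rightarrow> real" and \<alpha> :: real
  assumes "s \<ge> 1" and "n \<ge> 1" and "\<alpha> > 0"
  shows "(\<exists>f. solution_Q s n x y \<alpha> f \<and> solution_P s n x y \<alpha> f) \<and>
         (\<forall>f. solution_P s n x y \<alpha> f \<longrightarrow> solution_Q s n x y \<alpha> f)"
proof -
  let ?R = "patterns s n x"
  let ?P = "penalized_loss (V_XGB s) n x y \<alpha>" and ?Q = "penalized_loss (V_inf_XGB s) n x y \<alpha>"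
  define \<Phi> where "\<Phi> c w = (\<Sum>i=1..n. (y i - (c + (\<Sum>p\<in>?R. w p * of_bool (i \<in> p))))\<^sup>2) +
    \<alpha> * (\<Sum>p\<in>?R. \<bar>w p\<bar>)" for c w
  have "\<exists>c w. \<forall>c' w'. \<Phi> c w \<le> \<Phi> c' w'"
    unfolding \<Phi>_def using assms
    by (intro l1_least_squares_attains_min[where a = "\<lambda>i p. of_bool (i \<in> p)"] finite_patterns) auto
  then obtain c w where min: "\<And>c' w'. \<Phi> c w \<le> \<Phi> c' w'" by blast
  have Q_ge: "\<Phi> c w \<le> ?Q g" if "g \<in> F_inf_ST s" for g
  proof -
    let ?S = "\<Sum>i=1..n. (y i - g (x i))\<^sup>2"
    \<comment> \<open>The desired inequality is solved for the penalty, so that a bound on every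
      representation passes to the infimum.\<close>
    have "(\<Phi> c w - ?S) / \<alpha> \<le> V_inf_XGB s g"
      unfolding V_inf_XGB_def
    proof (rule cInf_greatest)
      show "{\<Sum>(L, U)\<in>index_pairs s. TV_norm (thr_space L U) (\<nu> L U) |c \<nu>. inf_ST_rep s c \<nu> g} \<noteq> {}"
        using that by (auto simp: F_inf_ST_def)
      fix v
      assume "v \<in> {\<Sum>(L, U)\<in>index_pairs s. TV_norm (thr_space L U) (\<nu> L U) |c \<nu>. inf_ST_rep s c \<nu> g}"
      then obtain c' \<nu> where v: "v = (\<Sum>(L, U)\<in>index_pairs s. TV_norm (thr_space L U) (\<nu> L U))"
        and rep: "inf_ST_rep s c' \<nu> g"
        by blast
      obtain w' where g: "\<forall>i\<in>{1..n}. g (x i) = c' + (\<Sum>P\<in>?R. w' P * of_bool (i \<in> P))"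
        and w': "(\<Sum>P\<in>?R. \<bar>w' P\<bar>) \<le> v"
        using inf_ST_rep_on_data[OF rep, of n x] v by blast
      have "\<Phi> c w \<le> \<Phi> c' w'" by (rule min)
      also have "\<dots> = ?S + \<alpha> * (\<Sum>P\<in>?R. \<bar>w' P\<bar>)"
        using g by (simp add: \<Phi>_def)
      also have "\<dots> \<le> ?S + \<alpha> * v" using w' \<open>\<alpha> > 0\<close> by simp
      finally show "(\<Phi> c w - ?S) / \<alpha> \<le> v"
        using \<open>\<alpha> > 0\<close> by (simp add: pos_divide_le_eq mult.commute)
    qed
    then show ?thesis
      using \<open>\<alpha> > 0\<close> by (simp add: penalized_loss_def pos_divide_le_eq mult.commute)
  qed
  \<comment> \<open>One basis function \<open>r P\<close> is chosen for each pattern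
    \<open>P\<close>. Giving it the optimal weight \<open>w P\<close> yields a function with the
    optimal predictions on the data.\<close>
  define atom where "atom P z \<longleftrightarrow> (case z of (L, U, q) \<Rightarrow> (L, U) \<in> index_pairs s \<and> pattern n x L U q = P)" for P z
  have "\<forall>P\<in>?R. \<exists>z. atom P z"
    by (auto simp: patterns_def atom_def)
  from bchoice[OF this] obtain r where r: "\<forall>P\<in>?R. atom P (r P)" ..
  obtain Ps where Ps: "set Ps = ?R" "distinct Ps"
    using finite_distinct_list[OF finite_patterns] by blast
  define as where "as = map (\<lambda>P. (w P, r P)) Ps"
  define f where "f = (\<lambda>x. c + atom_sum as x)"
  have as: "\<forall>(w, L, U, q)\<in>set as. (L, U) \<in> index_pairs s"
    using r Ps(1) by (auto simp: as_def atom_def)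
  have cost: "atom_cost as = (\<Sum>P\<in>?R. \<bar>w P\<bar>)"
    unfolding Ps(1)[symmetric] using Ps(2)
    by (simp add: as_def atom_cost_def o_def split_beta sum_list_distinct_conv_sum_set)
  have val: "f (x i) = c + (\<Sum>P\<in>?R. w P * of_bool (i \<in> P))" if i: "i \<in> {1..n}" for i
  proof -
    have "atom_sum as (x i) = (\<Sum>P\<in>?R. w P * (\<lambda>(L, U, q). basis_fun L U q (x i)) (r P))"
      unfolding Ps(1)[symmetric] using Ps(2)
      by (simp add: as_def atom_sum_def o_def split_beta sum_list_distinct_conv_sum_set)
    also have "\<dots> = (\<Sum>P\<in>?R. w P * of_bool (i \<in> P))"
      using r by (intro sum.cong refl) (auto simp: atom_def split_beta basis_fun_pattern[OF i])
    finally show ?thesis by (simp add: f_def)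
  qed
  have f: "f \<in> F_ST s" "V_XGB s f \<le> (\<Sum>P\<in>?R. \<bar>w P\<bar>)"
    using F_ST_atom_sum[OF as, of c] by (simp_all add: f_def cost)
  have "?P f \<le> \<Phi> c w"
    using f(2) \<open>\<alpha> > 0\<close> by (simp add: penalized_loss_def \<Phi>_def val)
  have Q_le_P: "?Q g \<le> ?P g" if "g \<in> F_ST s" for g
    using F_ST_subset_F_inf_ST(2)[OF that] \<open>\<alpha> > 0\<close> by (simp add: penalized_loss_def)
  \<comment> \<open>The finite-dimensional minimum lies between the two objectives: it bounds
    \<open>?P f\<close> from above and every \<open>?Q g\<close> from below.\<close>
  have P_f: "?P f \<le> ?Q g" if "g \<in> F_inf_ST s" for g
    using \<open>?P f \<le> \<Phi> c w\<close> Q_ge[OF that] by linarith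
  have sol_P: "solution_P s n x y \<alpha> f"
    unfolding solution_P_def is_arg_min_def
    using f(1) by (auto simp: not_less intro!: order_trans[OF P_f Q_le_P] F_ST_subset_F_inf_ST(1))
  have "solution_Q s n x y \<alpha> g" if "solution_P s n x y \<alpha> g" for g
  proof -
    have g: "g \<in> F_ST s" "?P g \<le> ?P f"
      using that f(1) unfolding solution_P_def is_arg_min_def by (auto simp: not_less)
    then have "?Q g \<le> ?Q h" if "h \<in> F_inf_ST s" for h
      using Q_le_P[OF g(1)] P_f[OF that] by linarith
    then show ?thesis
      using F_ST_subset_F_inf_ST(1)[OF g(1)] unfolding solution_Q_def is_arg_min_def
      by (auto simp: not_less)
  qed
  with sol_P show ?thesis by blast
qed

end
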